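(* For any positive integer $n$, we have $\chi_b(KG(m,n))=\Theta(m^n)$ (as $m\to\infty$ with $n$ fixed).
   Context: For a positive integer $m$, $[m]$ denotes the set $\{0,1,\ldots,m-1\}$, and $\binom{[m]}{n}$ denotes the collection of all $n$-element subsets of $[m]$. For $m\geq 2n$, the Kneser graph $KG(m,n)$ is the graph with vertex set $\binom{[m]}{n}$ in which two vertices $A$ and $B$ are adjacent if and only if $A\cap B=\emptyset$. The b-chromatic number $\chi_b(G)$ of a graph $G$ is the largest positive integer $t$ such that there exists a proper vertex coloring of $G$ with $t$ colors (all $t$ color classes nonempty) in which every color class contains at least one vertex that has a neighbor in each of the other color classes. The notation $\chi_b(KG(m,n))=\Theta(m^n)$ means: there exist real constants $c_1,c_2>0$ and an integer $m_0$ (all depending on $n$ only) such that $c_1 m^n\leq \chi_b(KG(m,n))\leq c_2 m^n$ for all integers $m\geq m_0$. *)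

theory Defs
  imports "HOL-Library.Landau_Symbols" "Graph_Theory.Pair_Digraph"
begin

text \<open>
  A finite simple graph is a \<^locale>\<open>pair_graph\<close>: a finite, loop-free digraph whose arc set is
  symmetric, so each edge occurs as a pair of opposite arcs.
\<close>

definition kneser_verts :: "nat \<Rightarrow> nat \<Rightarrow> nat set set" where
  "kneser_verts m n = {A. A \<subseteq> {0..<m} \<and> card A = n}"

definition kneser_graph :: "nat \<Rightarrow> nat \<Rightarrow> nat set pair_pre_digraph" where
  "kneser_graph m n =
     \<lparr> pverts = kneser_verts m n,
       parcs = {(A, B). A \<in> kneser_verts m n \<and> B \<in> kneser_verts m n \<and> A \<inter> B = {}} \<rparr>"

lemma pair_graph_kneser_graph:
  assumes "n > 0"
  shows "pair_graph (kneser_graph m n)"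
proof
  have "finite (kneser_verts m n)"
    by (rule finite_subset[of _ "Pow {0..<m}"]) (auto simp: kneser_verts_def)
  then show fin: "finite (pverts (kneser_graph m n))"
    by (simp add: kneser_graph_def)
  have "parcs (kneser_graph m n) \<subseteq> pverts (kneser_graph m n) \<times> pverts (kneser_graph m n)"
    by (auto simp: kneser_graph_def)
  then show "finite (parcs (kneser_graph m n))"
    by (rule finite_subset) (intro finite_cartesian_product fin)
next
  fix e assume "e \<in> parcs (kneser_graph m n)"
  then have e: "fst e \<in> kneser_verts m n" "snd e \<in> kneser_verts m n" "fst e \<inter> snd e = {}"
    by (auto simp: kneser_graph_def)
  then show "fst e \<in> pverts (kneser_graph m n)" "snd e \<in> pverts (kneser_graph m n)"
    by (simp_all add: kneser_graph_def)
  show "fst e \<noteq> snd e"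
    using e assms by (force simp: kneser_verts_def)
next
  have "sym (parcs (kneser_graph m n))"
    by (rule symI) (simp add: kneser_graph_def Int_commute)
  then show "symmetric (with_proj (kneser_graph m n))"
    by (simp add: symmetric_def)
qed

text \<open>
  The colours are \<open>0, \<dots>, t - 1\<close>; the image condition makes all \<open>t\<close> colour classes nonempty.
\<close>

definition proper_coloring :: "'a pair_pre_digraph \<Rightarrow> nat \<Rightarrow> ('a \<Rightarrow> nat) \<Rightarrow> bool" where
  "proper_coloring G t c \<longleftrightarrow>
     c ` pverts G = {0..<t} \<and> (\<forall>(u, v) \<in> parcs G. c u \<noteq> c v)"

definition b_coloring :: "'a pair_pre_digraph \<Rightarrow> nat \<Rightarrow> ('a \<Rightarrow> nat) \<Rightarrow> bool" where
  "b_coloring G t c \<longleftrightarrow> proper_coloring G t c \<and>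
     (\<forall>i<t. \<exists>v\<in>pverts G. c v = i \<and>
        (\<forall>j<t. j \<noteq> i \<longrightarrow> (\<exists>w\<in>pverts G. (v, w) \<in> parcs G \<and> c w = j)))"

text \<open>
  For a finite nonempty graph the maximum is over a finite nonempty set: \<open>t\<close> is at most the
  number of vertices, and a proper colouring with the fewest colours is a b-colouring.
\<close>

definition b_chromatic_number :: "'a pair_pre_digraph \<Rightarrow> nat" where
  "b_chromatic_number G = Max {t. t > 0 \<and> (\<exists>c. b_coloring G t c)}"

lemma finite_b_coloring_sizes:
  assumes "finite (pverts G)"
  shows "finite {t. t > 0 \<and> (\<exists>c. b_coloring G t c)}"
proof (rule finite_subset)
  show "{t. t > 0 \<and> (\<exists>c. b_coloring G t c)} \<subseteq> {..card (pverts G)}"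
  proof (clarsimp)
    fix t c assume "b_coloring G t c"
    then have "card (c ` pverts G) = t"
      by (simp add: b_coloring_def proper_coloring_def)
    then show "t \<le> card (pverts G)"
      using card_image_le[OF assms, of c] by simp
  qed
qed simp

lemma bigtheta_power_iff:
  fixes f :: "nat \<Rightarrow> nat"
  shows "(\<lambda>m. real (f m)) \<in> \<Theta>(\<lambda>m. real m ^ n) \<longleftrightarrow>
    (\<exists>c1>0. \<exists>c2>0. \<exists>m0. \<forall>m\<ge>m0. c1 * real m ^ n \<le> real (f m) \<and> real (f m) \<le> c2 * real m ^ n)"
    (is "?L \<longleftrightarrow> ?R")
proof
  assume ?L
  then have "(\<lambda>m. real (f m)) \<in> O(\<lambda>m. real m ^ n)" "(\<lambda>m. real (f m)) \<in> \<Omega>(\<lambda>m. real m ^ n)"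
    by (auto simp: bigtheta_def)
  then obtain c1 c2 where c: "c1 > 0" "c2 > 0"
    "eventually (\<lambda>m. c1 * real m ^ n \<le> real (f m)) sequentially"
    "eventually (\<lambda>m. real (f m) \<le> c2 * real m ^ n) sequentially"
    by (auto simp: bigo_def bigomega_def)
  show ?R
    using c(1,2) eventually_conj[OF c(3,4)] unfolding eventually_sequentially by blast
next
  assume ?R
  then obtain c1 c2 m0 where "c1 > 0" "c2 > 0"
    "\<And>m. m \<ge> m0 \<Longrightarrow> c1 * real m ^ n \<le> real (f m) \<and> real (f m) \<le> c2 * real m ^ n"
    by blast
  then show ?L
    by (intro bigthetaI bigoI[of _ c2] landau_omega.bigI[of c1])
      (auto simp: eventually_sequentially)
qed

end

theory Submission
  imports Defs
begin

text \<open>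
  Fix \<open>k\<close> proportional to \<open>m\<close>. Every \<open>n\<close>-subset \<open>B\<close> of \<open>{0..<k}\<close> gets an \<open>(n - 1)\<close>-set \<open>h B\<close> of points
  beyond \<open>k + n\<close>, and the sets \<open>B\<close> and \<open>{b} \<union> h B\<close> for \<open>b \<in> B\<close> form one colour class; these classes
  are disjoint if \<open>h\<close> separates any two different sets that meet. If \<open>C \<noteq> B\<close>, then \<open>B\<close> is adjacent
  to \<open>{c} \<union> h C\<close> for any \<open>c \<in> C - B\<close>, so \<open>B\<close> sees all the other classes of this kind. The remaining
  vertices are coloured by their maximum, and \<open>B\<close> sees those colours as well. A colour class without
  a vertex that sees all other colours can be dissolved into the other classes, and this does not
  harm the vertices \<open>B\<close>. So a b-colouring with at least \<open>k choose n\<close> colours remains.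
\<close>

section \<open>B-colourings from colourings with many vertices that see all colours\<close>

definition sees_all_colours :: "'a pair_pre_digraph \<Rightarrow> ('a \<Rightarrow> 'c) \<Rightarrow> 'a \<Rightarrow> bool" where
  "sees_all_colours G c v \<longleftrightarrow>
     (\<forall>j\<in>c ` pverts G. j \<noteq> c v \<longrightarrow> (\<exists>w\<in>pverts G. (v, w) \<in> parcs G \<and> c w = j))"

text \<open>Colours of any type are renumbered along a bijection from the palette to an initial
  segment of the naturals. Hence the constructions below may use a sum type and drop colours
  freely.\<close>

lemma b_coloring_if_all_seen:
  fixes c :: "'a \<Rightarrow> 'c"
  assumes fin: "finite (pverts G)"
    and arcs: "parcs G \<subseteq> pverts G \<times> pverts G"
    and proper: "\<And>u v. (u, v) \<in> parcs G \<Longrightarrow> c u \<noteq> c v"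
    and seen: "\<And>j. j \<in> c ` pverts G \<Longrightarrow> \<exists>v\<in>pverts G. c v = j \<and> sees_all_colours G c v"
  shows "\<exists>c'. b_coloring G (card (c ` pverts G)) c'"
proof -
  let ?P = "c ` pverts G"
  from fin have "finite ?P" by simp
  then obtain f where f: "bij_betw f ?P {0..<card ?P}"
    using ex_bij_betw_finite_nat by blast
  then have inj: "inj_on f ?P" and im: "f ` ?P = {0..<card ?P}"
    by (auto simp: bij_betw_def)
  have "proper_coloring G (card ?P) (f \<circ> c)"
    unfolding proper_coloring_def
  proof (intro conjI)
    show "(f \<circ> c) ` pverts G = {0..<card ?P}"
      using im by (simp add: image_comp)
    show "\<forall>(u, v)\<in>parcs G. (f \<circ> c) u \<noteq> (f \<circ> c) v"
    proof clarify
      fix u v assume uv: "(u, v) \<in> parcs G" "(f \<circ> c) u = (f \<circ> c) v"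
      then have "u \<in> pverts G" "v \<in> pverts G" using arcs by auto
      with uv(2) inj have "c u = c v" by (auto dest: inj_onD)
      with proper uv(1) show False by blast
    qed
  qed
  moreover have "\<exists>v\<in>pverts G. (f \<circ> c) v = i \<and> (\<forall>j<card ?P. j \<noteq> i \<longrightarrow>
      (\<exists>w\<in>pverts G. (v, w) \<in> parcs G \<and> (f \<circ> c) w = j))" if i: "i < card ?P" for i
  proof -
    have "i \<in> f ` ?P" using i im by simp
    then obtain a where a: "a \<in> ?P" "f a = i" by blast
    with seen obtain v where v: "v \<in> pverts G" "c v = a" "sees_all_colours G c v" by blast
    have "\<exists>w\<in>pverts G. (v, w) \<in> parcs G \<and> (f \<circ> c) w = j" if j: "j < card ?P" "j \<noteq> i" for j
    proof -
      have "j \<in> f ` ?P" using j im by simp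
      then obtain b where b: "b \<in> ?P" "f b = j" by blast
      with j a v have "b \<noteq> c v" by auto
      with b v(3) obtain w where "w \<in> pverts G" "(v, w) \<in> parcs G" "c w = b"
        by (auto simp: sees_all_colours_def)
      with b show ?thesis by auto
    qed
    with v a show ?thesis by auto
  qed
  ultimately have "b_coloring G (card ?P) (f \<circ> c)"
    by (auto simp: b_coloring_def)
  then show ?thesis by blast
qed

text \<open>Induction on the number of colours. A colour without an all-seeing vertex is removed by
  moving each of its vertices to a colour missing among its neighbours. The vertices in
  \<open>S\<close> never move, so their distinct colours survive to the end.\<close>

lemma ex_b_coloring_ge:
  fixes c :: "'a \<Rightarrow> 'c"
  assumes fin: "finite (pverts G)"
    and arcs: "parcs G \<subseteq> pverts G \<times> pverts G"
    and sym: "sym (parcs G)"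
    and proper: "\<And>u v. (u, v) \<in> parcs G \<Longrightarrow> c u \<noteq> c v"
    and S: "S \<subseteq> pverts G" "inj_on c S" "\<And>v. v \<in> S \<Longrightarrow> sees_all_colours G c v"
  shows "\<exists>t c'. b_coloring G t c' \<and> card S \<le> t"
  using proper S
proof (induction "card (c ` pverts G)" arbitrary: c rule: less_induct)
  case less
  let ?P = "c ` pverts G"
  show ?case
  proof (cases "\<forall>j\<in>?P. \<exists>v\<in>pverts G. c v = j \<and> sees_all_colours G c v")
    case True
    with b_coloring_if_all_seen[OF fin arcs, of c] less.prems(1)
    obtain c' where "b_coloring G (card ?P) c'" by blast
    moreover have "card S \<le> card ?P"
      using card_mono[of ?P "c ` S"] fin less.prems(2,3) by (auto simp: card_image)
    ultimately show ?thesis by blast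
  next
    case False
    then obtain j where j: "j \<in> ?P" "\<And>v. v \<in> pverts G \<Longrightarrow> c v = j \<Longrightarrow> \<not> sees_all_colours G c v"
      by blast
    define r where "r v = (SOME i. i \<in> ?P \<and> i \<noteq> j \<and> (\<forall>w\<in>pverts G. (v, w) \<in> parcs G \<longrightarrow> c w \<noteq> i))" for v
    have r: "r v \<in> ?P \<and> r v \<noteq> j \<and> (\<forall>w\<in>pverts G. (v, w) \<in> parcs G \<longrightarrow> c w \<noteq> r v)"
      if "v \<in> pverts G" "c v = j" for v
    proof -
      have "\<exists>i. i \<in> ?P \<and> i \<noteq> j \<and> (\<forall>w\<in>pverts G. (v, w) \<in> parcs G \<longrightarrow> c w \<noteq> i)"
        using j(2)[OF that] that(2) unfolding sees_all_colours_def by blast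
      then show ?thesis unfolding r_def by (rule someI_ex)
    qed
    define d where "d v = (if c v = j then r v else c v)" for v
    have d_im: "d ` pverts G \<subseteq> ?P - {j}"
      using r by (auto simp: d_def)
    have "card (d ` pverts G) < card ?P"
      using d_im j(1) fin by (intro psubset_card_mono) auto
    \<comment> \<open>Two adjacent vertices cannot both have colour \<open>j\<close>, so at most one
      end of the arc moves, and it moves to a colour that the other end does not have.\<close>
    moreover have "d u \<noteq> d v" if uv: "(u, v) \<in> parcs G" for u v
    proof -
      have "(v, u) \<in> parcs G" "u \<in> pverts G" "v \<in> pverts G"
        using uv sym arcs by (auto dest: symD)
      then show ?thesis
        using r[of u] r[of v] less.prems(1)[OF uv] uv unfolding d_def by metis
    qed
    moreover have c_S: "c v \<noteq> j" "d v = c v" if "v \<in> S" for v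
      using that less.prems(2,4) j(2) by (auto simp: d_def)
    moreover have "inj_on d S"
      using less.prems(3) c_S(2) by (simp cong: inj_on_cong)
    moreover have "sees_all_colours G d v" if v: "v \<in> S" for v
      unfolding sees_all_colours_def
    proof (intro ballI impI)
      fix i assume i: "i \<in> d ` pverts G" "i \<noteq> d v"
      \<comment> \<open>As \<open>i \<noteq> j\<close>, the old neighbour of colour \<open>i\<close>
        is not recoloured.\<close>
      with d_im c_S(2)[OF v] have "i \<in> ?P" "i \<noteq> j" "i \<noteq> c v" by auto
      with less.prems(4)[OF v] obtain w where "w \<in> pverts G" "(v, w) \<in> parcs G" "c w = i"
        by (auto simp: sees_all_colours_def)
      with \<open>i \<noteq> j\<close> show "\<exists>w\<in>pverts G. (v, w) \<in> parcs G \<and> d w = i"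
        by (auto simp: d_def)
    qed
    ultimately show ?thesis
      using less.hyps[of d] less.prems(2) by blast
  qed
qed

section \<open>Colouring the Kneser graph by means of a separating map\<close>

lemma card_kneser_verts: "card (kneser_verts m n) = m choose n"
  using n_subsets[of "{0..<m}" n] by (simp add: kneser_verts_def)

lemma finite_kneser_verts: "finite (kneser_verts m n)"
  by (rule finite_subset[of _ "Pow {0..<m}"]) (auto simp: kneser_verts_def)

text \<open>The gap \<open>{k..<k + n}\<close> stays free of the sets \<open>h B\<close>, and
  \<open>2 * n \<le> k\<close> leaves at least \<open>n - 1\<close> points below \<open>k\<close>
  outside \<open>B\<close>. These two reserves provide neighbours of \<open>B\<close> in the colours
  that are given by a maximum.\<close>

lemma b_coloring_kneser_ge:
  fixes h :: "nat set \<Rightarrow> nat set"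
  assumes n: "n \<ge> 1" and k: "2 * n \<le> k" and km: "k + n \<le> m"
    and h: "\<And>B. B \<in> kneser_verts k n \<Longrightarrow> h B \<subseteq> {k + n..<m} \<and> card (h B) = n - 1"
    and h_sep: "\<And>B C. \<lbrakk>B \<in> kneser_verts k n; C \<in> kneser_verts k n; B \<inter> C \<noteq> {}; h B = h C\<rbrakk> \<Longrightarrow> B = C"
  shows "\<exists>t c. b_coloring (kneser_graph m n) t c \<and> (k choose n) \<le> t"
proof -
  let ?V = "kneser_verts k n"
  define K where "K B = insert B ((\<lambda>b. insert b (h B)) ` B)" for B
  define c :: "nat set \<Rightarrow> nat set + nat"
    where "c S = (if \<exists>B\<in>?V. S \<in> K B then Inl (THE B. B \<in> ?V \<and> S \<in> K B) else Inr (Max S))" for S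
  have V: "B \<subseteq> {0..<k}" "card B = n" "finite B" "B \<noteq> {}" if "B \<in> ?V" for B
    using that n by (auto simp: kneser_verts_def intro: finite_subset)
  have h_fin: "finite (h B)" if "B \<in> ?V" for B
    using h[OF that] by (auto intro: finite_subset)
  have hV: "x \<ge> k + n" "x < m" if "B \<in> ?V" "x \<in> h B" for B x
    using h[OF that(1)] that(2) by auto
  have K_vert: "S \<in> kneser_verts m n" if "B \<in> ?V" "S \<in> K B" for B S
  proof (cases "S = B")
    case True
    with V[OF that(1)] km show ?thesis by (auto simp: kneser_verts_def)
  next
    case False
    with that obtain b where b: "b \<in> B" "S = insert b (h B)" by (auto simp: K_def)
    then have "b < k" using V(1)[OF that(1)] by auto
    then have "b \<notin> h B" using hV(1)[OF that(1), of b] by auto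
    then have "card S = n"
      using b h[OF that(1)] h_fin[OF that(1)] n by simp
    then show ?thesis
      using b \<open>b < k\<close> km hV(2)[OF that(1)] by (auto simp: kneser_verts_def)
  qed
  have K_uniq: "B = C" if BC: "B \<in> ?V" "C \<in> ?V" "S \<in> K B" "S \<in> K C" for B C S
  proof -
    \<comment> \<open>\<open>B\<close> lies below \<open>k\<close> and \<open>h C\<close> beyond the
      gap, so \<open>h C\<close> must be empty; this can only happen for
      \<open>n = 1\<close>.\<close>
    have mixed: "B = C" if BC: "B \<in> ?V" "C \<in> ?V" and x: "x \<in> C" "B = insert x (h C)" for B C x
    proof -
      have "h C = {}"
        using x(2) V(1)[OF BC(1)] hV(1)[OF BC(2)] by fastforce
      with x have "B \<subseteq> C" by auto
      with V[OF BC(1)] V[OF BC(2)] show ?thesis by (simp add: card_subset_eq)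
    qed
    \<comment> \<open>\<open>x\<close> and \<open>y\<close> are the only points below
      \<open>k\<close> on their sides, so they coincide. Then \<open>B\<close> and \<open>C\<close>
      meet and \<open>h_sep\<close> applies.\<close>
    have two: "B = C" if x: "x \<in> B" "y \<in> C" "insert x (h B) = insert y (h C)" for x y
    proof -
      have lt: "x < k" "y < k" using x V(1)[OF BC(1)] V(1)[OF BC(2)] by auto
      then have nin: "x \<notin> h C" "y \<notin> h B" "x \<notin> h B" "y \<notin> h C"
        using hV(1)[OF BC(1)] hV(1)[OF BC(2)] by fastforce+
      with x(3) have "x = y" by auto
      with nin x(3) have "h B = h C" by auto
      moreover have "B \<inter> C \<noteq> {}" using x \<open>x = y\<close> by auto
      ultimately show ?thesis using h_sep BC by blast
    qed
    have "S = B \<or> (\<exists>x\<in>B. S = insert x (h B))" "S = C \<or> (\<exists>y\<in>C. S = insert y (h C))"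
      using BC(3,4) by (auto simp: K_def)
    then show ?thesis
      using mixed[OF BC(1,2)] mixed[OF BC(2,1)] two by metis
  qed
  have c_Inl: "c S = Inl B" if "B \<in> ?V" "S \<in> K B" for B S
  proof -
    have "(THE B. B \<in> ?V \<and> S \<in> K B) = B"
      using that K_uniq by (intro the_equality) auto
    with that show ?thesis by (auto simp: c_def)
  qed
  have c_Inr: "c S = Inr (Max S)" if "\<And>B. B \<in> ?V \<Longrightarrow> S \<notin> K B" for S
    using that by (auto simp: c_def)
  \<comment> \<open>For \<open>n = 1\<close> all members contain the one point of \<open>B\<close>.
    Otherwise the members \<open>insert b (h B)\<close> share the nonempty \<open>h B\<close>, and
    each of them meets \<open>B\<close> in \<open>b\<close>.\<close>
  have K_meets: "S \<inter> T \<noteq> {}" if "B \<in> ?V" "S \<in> K B" "T \<in> K B" for B S T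
  proof (cases "n = 1")
    case True
    with V(2)[OF that(1)] obtain b where "B = {b}" by (auto simp: card_1_singleton_iff)
    with that(2,3) show ?thesis by (auto simp: K_def)
  next
    case False
    then have "h B \<noteq> {}" using h[OF that(1)] n by auto
    with that(2,3) V(4)[OF that(1)] show ?thesis by (auto simp: K_def)
  qed
  \<comment> \<open>Two tests for lying outside every class \<open>K B\<close>: having no point
    below \<open>k\<close>, or having a point in the gap.\<close>
  have K_ends: "\<exists>x\<in>S. x < k" "\<And>x. x \<in> S \<Longrightarrow> x < k \<or> x \<ge> k + n" if "B \<in> ?V" "S \<in> K B" for B S
  proof -
    show "\<exists>x\<in>S. x < k" using that V[OF that(1)] by (fastforce simp: K_def)
    show "x < k \<or> x \<ge> k + n" if "x \<in> S" for x
      using \<open>S \<in> K B\<close> that V(1)[OF \<open>B \<in> ?V\<close>] hV(1)[OF \<open>B \<in> ?V\<close>] by (fastforce simp: K_def)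
  qed
  have proper: "c S \<noteq> c T" if ST: "(S, T) \<in> parcs (kneser_graph m n)" for S T
  proof
    assume eq: "c S = c T"
    have ST': "S \<inter> T = {}" "finite S" "finite T" "S \<noteq> {}" "T \<noteq> {}"
      using ST n by (auto simp: kneser_graph_def kneser_verts_def intro: finite_subset)
    show False
    proof (cases "\<exists>B\<in>?V. S \<in> K B")
      case True
      then obtain B where B: "B \<in> ?V" "S \<in> K B" by blast
      have "\<exists>C\<in>?V. T \<in> K C"
        using eq c_Inl[OF B] c_Inr[of T] by fastforce
      then obtain C where C: "C \<in> ?V" "T \<in> K C" by blast
      with eq c_Inl[OF B] c_Inl[OF C] have "B = C" by simp
      with K_meets B C ST'(1) show False by blast
    next
      case False
      have "\<not> (\<exists>C\<in>?V. T \<in> K C)"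
        using eq c_Inl c_Inr[of S] False by fastforce
      with False eq c_Inr[of S] c_Inr[of T] have "Max S = Max T" by auto
      then have "Max S \<in> S \<inter> T"
        using ST'(2-5) Max_in[of S] Max_in[of T] by simp
      with ST'(1) show False by simp
    qed
  qed
  have sees: "sees_all_colours (kneser_graph m n) c B" if B: "B \<in> ?V" for B
    unfolding sees_all_colours_def
  proof (intro ballI impI)
    fix j assume "j \<in> c ` pverts (kneser_graph m n)" and jB: "j \<noteq> c B"
    then obtain T where T: "T \<in> kneser_verts m n" "j = c T" by (auto simp: kneser_graph_def)
    have B_vert: "B \<in> kneser_verts m n" using K_vert[OF B, of B] by (simp add: K_def)
    have "\<exists>S\<in>kneser_verts m n. B \<inter> S = {} \<and> c S = j"
    proof (cases "\<exists>C\<in>?V. T \<in> K C")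
      case True
      then obtain C where C: "C \<in> ?V" "T \<in> K C" by blast
      have "B \<noteq> C" using jB T(2) c_Inl[OF C] c_Inl[OF B, of B] by (auto simp: K_def)
      then have "\<not> C \<subseteq> B" using V[OF B] V[OF C(1)] card_subset_eq by metis
      then obtain x where x: "x \<in> C" "x \<notin> B" by blast
      let ?S = "insert x (h C)"
      have "?S \<in> K C" using x by (simp add: K_def)
      moreover have "B \<inter> ?S = {}" using x V(1)[OF B] hV(1)[OF C(1)] by fastforce
      ultimately show ?thesis
        using K_vert[OF C(1)] c_Inl[OF C(1)] c_Inl[OF C] T(2) by metis
    next
      case False
      define z where "z = Max T"
      have T': "finite T" "T \<noteq> {}" "T \<subseteq> {0..<m}" "card T = n"
        using T(1) n by (auto simp: kneser_verts_def intro: finite_subset)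
      have jz: "j = Inr z" using c_Inr[of T] False T(2) by (auto simp: z_def)
      have "z < m" using Max_in[OF T'(1,2)] T'(3) by (auto simp: z_def)
      \<comment> \<open>A vertex contained in \<open>{0..<k}\<close> would belong to its own class
        \<open>K T\<close>.\<close>
      have "z \<ge> k"
      proof (rule ccontr)
        assume "\<not> z \<ge> k"
        then have "T \<subseteq> {0..<k}" using Max_ge[OF T'(1)] by (fastforce simp: z_def)
        with T' have "T \<in> ?V" by (simp add: kneser_verts_def)
        with False show False by (auto simp: K_def)
      qed
      \<comment> \<open>\<open>W\<close> completes \<open>z\<close> to a neighbour of
        \<open>B\<close> with maximum \<open>z\<close> outside all classes. If \<open>z\<close> is
        beyond the gap, the filler comes from the gap and no point is below \<open>k\<close>;
        otherwise \<open>z\<close> itself is in the gap and the filler comes from below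
        \<open>k\<close>.\<close>
      obtain W where W: "card W = n - 1" "finite W" "W \<inter> B = {}" "W \<subseteq> {..<z}"
          "(z \<ge> k + n \<and> (\<forall>x\<in>W. x \<ge> k)) \<or> z < k + n"
      proof (cases "z \<ge> k + n")
        case True
        then show ?thesis
          using V(1)[OF B] by (intro that[of "{k..<k + n - 1}"]) auto
      next
        case z: False
        have "card ({0..<k} - B) = k - n"
          using V[OF B] by (simp add: card_Diff_subset)
        with k have "n - 1 \<le> card ({0..<k} - B)" by simp
        then obtain W where "W \<subseteq> {0..<k} - B" "card W = n - 1"
          using obtain_subset_with_card_n by metis
        then show ?thesis
          using z \<open>z \<ge> k\<close> by (intro that[of W]) (auto intro: finite_subset)
      qed
      let ?S = "insert z W"
      have "z \<notin> W" using W(4) by auto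
      then have "card ?S = n" using W n by simp
      then have "?S \<in> kneser_verts m n"
        using W(4) \<open>z < m\<close> by (auto simp: kneser_verts_def)
      moreover have "B \<inter> ?S = {}" using W(3) V(1)[OF B] \<open>z \<ge> k\<close> by fastforce
      moreover have "?S \<notin> K C" if "C \<in> ?V" for C
        using K_ends[OF that, of ?S] W(5) \<open>z \<ge> k\<close> by fastforce
      then have "c ?S = Inr (Max ?S)" by (rule c_Inr)
      moreover have "Max ?S = z" using W(2,4) by (intro Max_eqI) auto
      ultimately show ?thesis using jz by metis
    qed
    with B_vert show "\<exists>w\<in>pverts (kneser_graph m n). (B, w) \<in> parcs (kneser_graph m n) \<and> c w = j"
      by (auto simp: kneser_graph_def)
  qed
  have "inj_on c ?V"
    using c_Inl by (auto simp: inj_on_def K_def)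
  moreover have "?V \<subseteq> pverts (kneser_graph m n)"
    using K_vert by (auto simp: kneser_graph_def K_def)
  moreover have "sym (parcs (kneser_graph m n))"
    by (rule symI) (simp add: kneser_graph_def Int_commute)
  ultimately have "\<exists>t c'. b_coloring (kneser_graph m n) t c' \<and> card ?V \<le> t"
    using proper sees finite_kneser_verts
    by (intro ex_b_coloring_ge[of _ c]) (auto simp: kneser_graph_def)
  then show ?thesis by (simp add: card_kneser_verts)
qed

section \<open>Separating sets that meet by sums of neighbouring elements\<close>

text \<open>
  Lists with equal sums of neighbours differ by an alternating vector \<open>(e, -e, e, \<dots>)\<close>. For \<open>e > 0\<close>
  the entries of the second list fall strictly between \<open>xs ! 0\<close> and \<open>xs ! 1\<close>, strictly between
  \<open>xs ! 2\<close> and \<open>xs ! 3\<close>, and so on.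
\<close>

lemma neighbour_sums_disjoint:
  fixes xs ys :: "nat list"
  assumes sorted: "sorted_wrt (<) xs" "sorted_wrt (<) ys"
    and len: "length xs = n" "length ys = n"
    and sums: "\<And>r. Suc r < n \<Longrightarrow> xs ! r + xs ! Suc r = ys ! r + ys ! Suc r"
    and lt: "xs ! 0 < ys ! 0"
  shows "set xs \<inter> set ys = {}"
proof -
  define e where "e = int (ys ! 0) - int (xs ! 0)"
  have "e > 0" using lt by (simp add: e_def)
  have diff: "int (ys ! r) = int (xs ! r) + (if even r then e else - e)" if "r < n" for r
    using that
  proof (induction r)
    case (Suc r)
    then have "int (xs ! r) + int (xs ! Suc r) = int (ys ! r) + int (ys ! Suc r)"
      using sums[of r] by linarith
    with Suc show ?case by auto
  qed (simp add: e_def)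
  have incr: "xs ! i < xs ! j" "ys ! i < ys ! j" if "i < j" "j < n" for i j
    using sorted that len by (auto simp: sorted_wrt_iff_nth_less)
  have False if p: "p < n" and r: "r < n" and eq: "xs ! p = ys ! r" for p r
  proof (cases "even r")
    case True
    with diff[OF r] \<open>e > 0\<close> eq have "xs ! r < xs ! p" by simp
    then have "r < p" using incr(1)[of p r] r by (metis less_asym nat_neq_iff)
    \<comment> \<open>An equal entry of \<open>xs\<close> comes after position \<open>r\<close>,
      hence is at least \<open>xs ! Suc r\<close>. But \<open>ys ! r < ys ! Suc r\<close>, and the
      latter is \<open>xs ! Suc r\<close> lowered by \<open>e\<close>.\<close>
    then have "Suc r < n" using p by simp
    then have "ys ! r < xs ! Suc r"
      using incr(2)[of r "Suc r"] diff[of "Suc r"] True \<open>e > 0\<close> by simp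
    moreover have "xs ! Suc r \<le> xs ! p"
      using incr(1)[of "Suc r" p] \<open>r < p\<close> p by (cases "Suc r = p") auto
    ultimately show False using eq by simp
  next
    case False
    then obtain s where s: "r = Suc s" by (cases r) auto
    from diff[OF r] False \<open>e > 0\<close> eq have "xs ! p < xs ! r" by simp
    then have "p < r" using incr(1)[of r p] p by (metis less_asym nat_neq_iff)
    have "xs ! s < ys ! r"
      using incr(2)[of s r] diff[of s] False s r \<open>e > 0\<close> by simp
    moreover have "xs ! p \<le> xs ! s"
      using incr(1)[of p s] \<open>p < r\<close> s r by (cases "p = s") auto
    ultimately show False using eq by simp
  qed
  then show ?thesis using len by (fastforce simp: in_set_conv_nth)
qed

text \<open>Disjointness, applied in both directions, forces equal first entries; the sums then fix
  the other entries one by one.\<close>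

lemma neighbour_sums_determine:
  fixes xs ys :: "nat list"
  assumes sorted: "sorted_wrt (<) xs" "sorted_wrt (<) ys"
    and len: "length xs = n" "length ys = n"
    and sums: "\<And>r. Suc r < n \<Longrightarrow> xs ! r + xs ! Suc r = ys ! r + ys ! Suc r"
    and meet: "set xs \<inter> set ys \<noteq> {}"
  shows "xs = ys"
proof -
  have "\<not> xs ! 0 < ys ! 0"
    using neighbour_sums_disjoint[OF sorted len sums] meet by blast
  moreover have "\<not> ys ! 0 < xs ! 0"
    using neighbour_sums_disjoint[OF sorted(2,1) len(2,1) sums[symmetric]] meet by blast
  ultimately have "xs ! 0 = ys ! 0" by simp
  have "xs ! r = ys ! r" if "r < n" for r
    using that
  proof (induction r)
    case (Suc r)
    with sums[of r] show ?case by simp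
  qed (use \<open>xs ! 0 = ys ! 0\<close> in simp)
  with len show ?thesis by (simp add: nth_equalityI)
qed

text \<open>\<open>h B\<close> stores the \<open>n - 1\<close> sums of neighbours in the sorted list
  of \<open>B\<close>, the sum with index \<open>r\<close> as an offset in block \<open>r\<close> of
  length \<open>2 * k\<close>. Each sum is below \<open>2 * k\<close>, so the unordered set
  \<open>h B\<close> reveals all sums with their positions.\<close>

lemma ex_separating_sets:
  assumes n: "n \<ge> 1" and m: "k + n + 2 * k * (n - 1) \<le> m"
  obtains h :: "nat set \<Rightarrow> nat set" where
    "\<And>B. B \<in> kneser_verts k n \<Longrightarrow> h B \<subseteq> {k + n..<m} \<and> card (h B) = n - 1"
    "\<And>B C. \<lbrakk>B \<in> kneser_verts k n; C \<in> kneser_verts k n; B \<inter> C \<noteq> {}; h B = h C\<rbrakk> \<Longrightarrow> B = C"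
proof -
  define s :: "nat set \<Rightarrow> nat \<Rightarrow> nat"
    where "s B r = sorted_list_of_set B ! r + sorted_list_of_set B ! Suc r" for B r
  define g where "g B r = k + n + (2 * k * r + s B r)" for B r
  define h where "h B = g B ` {..<n - 1}" for B
  have V: "finite B" "length (sorted_list_of_set B) = n" "B \<subseteq> {0..<k}" if "B \<in> kneser_verts k n" for B
    using that by (auto simp: kneser_verts_def intro: finite_subset)
  have s_less: "s B r < 2 * k" if "B \<in> kneser_verts k n" "r < n - 1" for B r
  proof -
    have "sorted_list_of_set B ! i < k" if "i < n" for i
    proof -
      have "sorted_list_of_set B ! i \<in> set (sorted_list_of_set B)"
        using V(2)[OF \<open>B \<in> _\<close>] that by (intro nth_mem) simp
      then show ?thesis using V[OF \<open>B \<in> _\<close>] by auto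
    qed
    from this[of r] this[of "Suc r"] that(2)
    have "sorted_list_of_set B ! r < k" "sorted_list_of_set B ! Suc r < k" by simp_all
    then show ?thesis by (simp add: s_def)
  qed
  have g_inj: "q = r \<and> s B q = s C r"
    if "B \<in> kneser_verts k n" "C \<in> kneser_verts k n" "q < n - 1" "r < n - 1" "g B q = g C r" for B C q r
  proof -
    have eq: "2 * k * q + s B q = 2 * k * r + s C r" using that(5) by (simp add: g_def)
    have less: "s B q < 2 * k" "s C r < 2 * k" using s_less that by auto
    have "(2 * k * q + s B q) div (2 * k) = q" "(2 * k * r + s C r) div (2 * k) = r"
      using less by (simp_all add: div_mult_self4)
    with eq have "q = r" by simp
    with eq show ?thesis by simp
  qed
  show thesis
  proof (rule that)
    fix B assume B: "B \<in> kneser_verts k n"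
    have "inj_on (g B) {..<n - 1}"
      using g_inj[OF B B] by (auto simp: inj_on_def)
    moreover have "g B r < m" if "r < n - 1" for r
    proof -
      have "2 * k * r + s B r < 2 * k * Suc r" using s_less[OF B that] by simp
      also have "\<dots> \<le> 2 * k * (n - 1)" using that by (intro mult_le_mono2) simp
      finally show ?thesis using m by (simp add: g_def)
    qed
    moreover have "g B r \<ge> k + n" for r by (simp add: g_def)
    ultimately show "h B \<subseteq> {k + n..<m} \<and> card (h B) = n - 1"
      by (auto simp: h_def card_image)
  next
    fix B C
    assume BC: "B \<in> kneser_verts k n" "C \<in> kneser_verts k n" "B \<inter> C \<noteq> {}" "h B = h C"
    have "s B r = s C r" if "r < n - 1" for r
    proof -
      have "g B r \<in> h C" using that BC(4) by (auto simp: h_def)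
      then obtain q where "q < n - 1" "g B r = g C q" by (auto simp: h_def)
      with g_inj[OF BC(1,2) that] show ?thesis by blast
    qed
    then have "sorted_list_of_set B = sorted_list_of_set C"
      using V[OF BC(1)] V[OF BC(2)] BC(3)
      by (intro neighbour_sums_determine[of _ _ n]) (auto simp: s_def)
    then show "B = C" using V(1)[OF BC(1)] V(1)[OF BC(2)] by (metis set_sorted_list_of_set)
  qed
qed

section \<open>Bounds for the b-chromatic number\<close>

lemma b_coloring_le_b_chromatic_number:
  assumes "finite (pverts G)" "b_coloring G t c" "t > 0"
  shows "t \<le> b_chromatic_number G"
  unfolding b_chromatic_number_def
  using finite_b_coloring_sizes[OF assms(1)] assms(2,3) by (intro Max_ge) auto

text \<open>The given b-colouring makes the set of sizes nonempty, so that its \<open>Max\<close> is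
  attained by some colouring.\<close>

lemma b_chromatic_number_le_card:
  assumes "finite (pverts G)" "b_coloring G s c" "s > 0"
  shows "b_chromatic_number G \<le> card (pverts G)"
proof -
  let ?T = "{t. t > 0 \<and> (\<exists>c. b_coloring G t c)}"
  have "Max ?T \<in> ?T"
    using finite_b_coloring_sizes[OF assms(1)] assms(2,3) by (intro Max_in) auto
  then obtain d where "d ` pverts G = {0..<Max ?T}"
    by (auto simp: b_coloring_def proper_coloring_def)
  then show ?thesis
    using card_image_le[OF assms(1), of d] by (simp add: b_chromatic_number_def)
qed

theorem corollary1:
  fixes n :: nat
  assumes "n \<ge> 1"
  shows "(\<lambda>m::nat. real (b_chromatic_number (kneser_graph m n))) \<in> \<Theta>(\<lambda>m. real m ^ n)"
  unfolding bigtheta_power_iff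
proof (intro exI conjI allI impI)
  show "(1 / (4 * real n ^ 2)) ^ n > 0" "(1::real) > 0" using assms by auto
  fix m :: nat assume m: "m \<ge> 4 * n ^ 2"
  \<comment> \<open>With \<open>n \<le> k\<close>, the space \<open>k + n + 2 * k * (n - 1)\<close>
    needed for \<open>h\<close> is at most \<open>2 * n * k \<le> m\<close>. The bound
    \<open>m \<ge> 4 * n ^ 2\<close> gives \<open>k \<ge> 2 * n\<close>.\<close>
  define k where "k = m div (2 * n)"
  have k_ge: "2 * n \<le> k"
    using div_le_mono[OF m, of "2 * n"] assms by (simp add: k_def power2_eq_square)
  have km: "k * (2 * n) \<le> m" by (simp add: k_def)
  \<comment> \<open>Rounding down costs at most a factor 2, so
    \<open>k / n \<ge> m / (4 * n ^ 2)\<close>; this is the source of the lower constant.\<close>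
  have "m < Suc k * (2 * n)"
    using assms by (simp add: k_def dividend_less_div_times)
  also have "\<dots> \<le> 2 * k * (2 * n)" using k_ge assms by (intro mult_le_mono1) simp
  finally have "m \<le> 4 * n * k" by (simp add: mult_ac)
  have "k + n + 2 * k * (n - 1) \<le> 2 * k + 2 * k * (n - 1)" using k_ge by simp
  also have "\<dots> = k * (2 * n)" using assms by (cases n) (auto simp: algebra_simps)
  finally have "k + n + 2 * k * (n - 1) \<le> m" using km by simp
  moreover from this have "k + n \<le> m" by simp
  ultimately obtain t c where tc: "b_coloring (kneser_graph m n) t c" "(k choose n) \<le> t"
    using ex_separating_sets[OF assms] b_coloring_kneser_ge[OF assms k_ge] by metis
  have fin: "finite (pverts (kneser_graph m n))"
    by (simp add: kneser_graph_def finite_kneser_verts)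
  have "t > 0"
    using tc(2) k_ge by (metis assms le_trans less_le_trans mult_2 le_add1 zero_less_binomial)
  have "real m \<le> 4 * real n * real k" using \<open>m \<le> 4 * n * k\<close> by (metis of_nat_le_iff of_nat_mult of_nat_numeral)
  then have "real m / (4 * real n ^ 2) \<le> real k / real n"
    using assms by (simp add: field_simps power2_eq_square)
  then have "(real m / (4 * real n ^ 2)) ^ n \<le> (real k / real n) ^ n"
    by (intro power_mono) auto
  also have "\<dots> \<le> real (k choose n)"
    using k_ge by (intro binomial_ge_n_over_k_pow_k) simp
  also have "\<dots> \<le> real (b_chromatic_number (kneser_graph m n))"
    using tc(2) b_coloring_le_b_chromatic_number[OF fin tc(1) \<open>t > 0\<close>] by simp
  finally show "(1 / (4 * real n ^ 2)) ^ n * real m ^ n \<le> real (b_chromatic_number (kneser_graph m n))"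
    by (simp add: power_divide)
  have "b_chromatic_number (kneser_graph m n) \<le> m choose n"
    using b_chromatic_number_le_card[OF fin tc(1) \<open>t > 0\<close>]
    by (simp add: kneser_graph_def card_kneser_verts)
  also have "\<dots> \<le> m ^ n"
    using \<open>k + n \<le> m\<close> by (intro binomial_le_pow) simp
  finally show "real (b_chromatic_number (kneser_graph m n)) \<le> 1 * real m ^ n"
    by (metis mult_1 of_nat_le_iff of_nat_power)
qed

end
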